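(* Let $\epsilon>0$. Consider an instance $\mathcal I$ of the single-machine problem in the context with $n$ jobs, let $P_{\max}$ be the maximum processing time of a job scheduled in some fixed optimal solution of $\mathcal I$, and let $K=2\epsilon P_{\max}/(n(n+1))$. Let $\mathcal I'$ be the instance obtained from $\mathcal I$ by discarding every job $j$ with $p_j>P_{\max}$ and replacing the processing time of every remaining job $j$ by $p'_j=\lceil p_j/K\rceil$ (profits and target $\Pi$ unchanged), and let $\mathcal J_{\mathcal I'}$ be the set of jobs of an optimal solution of $\mathcal I'$. Then scheduling the jobs of $\mathcal J_{\mathcal I'}$ (with their original processing times) in order of non-decreasing processing times gives a sum of completion times at most $(1+\epsilon)\mathsf{Opt}(\mathcal I)$.
   Context: Single-machine problem: there are $n$ jobs, job $j$ having processing time $p_j>0$ and profit $\pi_j\ge0$, all available at time $0$. Given a target $\Pi>0$, the goal is to choose a set $S$ of jobs with $\sum_{j\in S}\pi_j\ge\Pi$ and schedule them on a single machine so as to minimize $\sum_{j\in S}C_j$, where $C_j$ is the completion time of job $j$. $\mathsf{Opt}(\mathcal I)$ denotes the optimal value of instance $\mathcal I$. *)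

theory Defs
  imports Complex_Main
begin

record 'a sched_inst =
  jobs :: "'a set"
  ptime :: "'a \<Rightarrow> real"
  profit :: "'a \<Rightarrow> real"
  target :: real

definition valid_inst :: "'a sched_inst \<Rightarrow> bool" where
  "valid_inst I \<longleftrightarrow> finite (jobs I) \<and> (\<forall>j\<in>jobs I. ptime I j > 0 \<and> profit I j \<ge> 0) \<and> target I > 0"

text \<open>A solution is a set \<open>S\<close> of selected jobs together with a non-preemptive schedule, given by
  start times \<open>s\<close>. Idle time is allowed; the values of \<open>s\<close> outside \<open>S\<close> are irrelevant.\<close>

definition completion :: "'a sched_inst \<Rightarrow> ('a \<Rightarrow> real) \<Rightarrow> 'a \<Rightarrow> real" where
  "completion I s j = s j + ptime I j"

definition feasible :: "'a sched_inst \<Rightarrow> 'a set \<Rightarrow> ('a \<Rightarrow> real) \<Rightarrow> bool" where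
  "feasible I S s \<longleftrightarrow>
     S \<subseteq> jobs I \<and> (\<Sum>j\<in>S. profit I j) \<ge> target I \<and>
     (\<forall>j\<in>S. s j \<ge> 0) \<and>
     (\<forall>i\<in>S. \<forall>j\<in>S. i \<noteq> j \<longrightarrow> completion I s i \<le> s j \<or> completion I s j \<le> s i)"

definition total_completion :: "'a sched_inst \<Rightarrow> 'a set \<Rightarrow> ('a \<Rightarrow> real) \<Rightarrow> real" where
  "total_completion I S s = (\<Sum>j\<in>S. completion I s j)"

definition optimal :: "'a sched_inst \<Rightarrow> 'a set \<Rightarrow> ('a \<Rightarrow> real) \<Rightarrow> bool" where
  "optimal I S s \<longleftrightarrow> feasible I S s \<and>
     (\<forall>T t. feasible I T t \<longrightarrow> total_completion I S s \<le> total_completion I T t)"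

definition Opt :: "'a sched_inst \<Rightarrow> real" where
  "Opt I = Inf {total_completion I S s | S s. feasible I S s}"

text \<open>Start times when the jobs of the duplicate-free list \<open>xs\<close> are processed in list order from
  time 0 without idle time: \<open>j\<close> starts after all jobs that precede it in \<open>xs\<close>.\<close>

definition list_start :: "'a sched_inst \<Rightarrow> 'a list \<Rightarrow> 'a \<Rightarrow> real" where
  "list_start I xs j = (\<Sum>i\<leftarrow>takeWhile (\<lambda>i. i \<noteq> j) xs. ptime I i)"

definition rounded_inst :: "real \<Rightarrow> real \<Rightarrow> 'a sched_inst \<Rightarrow> 'a sched_inst" where
  "rounded_inst Pmax K I =
     I\<lparr>jobs := {j \<in> jobs I. ptime I j \<le> Pmax}, ptime := (\<lambda>j. of_int \<lceil>ptime I j / K\<rceil>)\<rparr>"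

end

theory Submission
  imports Defs
begin

text \<open>In any schedule of a set \<open>S\<close>, of two jobs one precedes the other and delays it by its processing
  time, so the sum of completion times is at least the sum of the processing times plus the sum of
  \<open>min (p i) (p j)\<close> over unordered pairs. The order of non-decreasing processing times attains this
  bound \<open>spt_cost p S\<close>, which is monotone and homogeneous in \<open>p\<close> and grows by \<open>K m (m + 1) / 2\<close>,
  with \<open>m = card S\<close>, when \<open>K\<close> is added to every processing time. Now chain these properties along
  \<open>p \<le> K p' \<le> p + K\<close>; the rounding loses at most \<open>K n (n + 1) / 2 = \<epsilon> Pmax\<close>, and
  \<open>Pmax \<le> Opt I\<close>.\<close>

text \<open>The double sum runs over ordered pairs, so it counts each unordered pair twice and each
  \<open>p j\<close> once on the diagonal; the extra sum evens this out before halving.\<close>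

definition spt_cost :: "('a \<Rightarrow> real) \<Rightarrow> 'a set \<Rightarrow> real" where
  "spt_cost p S = ((\<Sum>i\<in>S. \<Sum>j\<in>S. min (p i) (p j)) + (\<Sum>j\<in>S. p j)) / 2"

lemma spt_cost_mono:
  assumes "\<And>j. j \<in> S \<Longrightarrow> p j \<le> q j"
  shows "spt_cost p S \<le> spt_cost q S"
proof -
  have "(\<Sum>i\<in>S. \<Sum>j\<in>S. min (p i) (p j)) \<le> (\<Sum>i\<in>S. \<Sum>j\<in>S. min (q i) (q j))"
    by (intro sum_mono min.mono assms)
  moreover have "(\<Sum>j\<in>S. p j) \<le> (\<Sum>j\<in>S. q j)"
    by (intro sum_mono assms)
  ultimately show ?thesis
    by (simp add: spt_cost_def)
qed

lemma spt_cost_scale: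
  assumes "c \<ge> 0"
  shows "spt_cost (\<lambda>j. c * p j) S = c * spt_cost p S"
proof -
  have "min (c * x) (c * y) = c * min x y" for x y
    using assms by (simp add: min_mult_distrib_left)
  then show ?thesis
    by (simp add: spt_cost_def sum_distrib_left[symmetric] distrib_left)
qed

text \<open>With \<open>m = card S\<close>, each of the \<open>m * m\<close> minima and each of the
  \<open>m\<close> single terms grows by \<open>c\<close>.\<close>

lemma spt_cost_add_const:
  "spt_cost (\<lambda>j. p j + c) S = spt_cost p S + c * (real (card S) * (real (card S) + 1)) / 2"
proof -
  have "min (x + c) (y + c) = min x y + c" for x y
    by (simp add: min_def)
  then have "(\<Sum>i\<in>S. \<Sum>j\<in>S. min (p i + c) (p j + c))
      = (\<Sum>i\<in>S. \<Sum>j\<in>S. min (p i) (p j)) + real (card S) * (real (card S) * c)"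
    by (simp add: sum.distrib)
  then show ?thesis
    by (simp add: spt_cost_def sum.distrib field_simps)
qed

text \<open>Each pair formed with the longest job \<open>x\<close> contributes the other job's time,
  so the increment is the completion time of \<open>x\<close> when it runs last.\<close>

lemma spt_cost_insert:
  assumes "finite S" "x \<notin> S" "\<And>j. j \<in> S \<Longrightarrow> p j \<le> p x"
  shows "spt_cost p (insert x S) = spt_cost p S + (\<Sum>j\<in>S. p j) + p x"
proof -
  have "(\<Sum>j\<in>S. min (p x) (p j)) = (\<Sum>j\<in>S. p j)" "(\<Sum>j\<in>S. min (p j) (p x)) = (\<Sum>j\<in>S. p j)"
    using assms(3) by (auto intro!: sum.cong)
  then show ?thesis
    using assms(1,2) by (simp add: spt_cost_def sum.distrib field_simps)
qed

section \<open>Schedules given by lists\<close>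

lemma list_start_snoc:
  assumes "j \<in> set xs"
  shows "list_start I (xs @ [x]) j = list_start I xs j"
  using assms by (simp add: list_start_def)

lemma list_start_last:
  assumes "distinct (xs @ [x])"
  shows "list_start I (xs @ [x]) x = sum (ptime I) (set xs)"
proof -
  have "takeWhile (\<lambda>i. i \<noteq> x) (xs @ [x]) = xs"
    using assms by (subst takeWhile_append2) auto
  then show ?thesis
    using assms by (simp add: list_start_def sum_list_distinct_conv_sum_set)
qed

text \<open>Induction from the end: the last job is a longest one and completes at the total
  processing time, which is the increment in \<open>spt_cost_insert\<close>.\<close>

lemma total_completion_sorted_list:
  assumes "distinct xs" "sorted (map (ptime I) xs)"
  shows "total_completion I (set xs) (list_start I xs) = spt_cost (ptime I) (set xs)"
  using assms
proof (induction xs rule: rev_induct)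
  case Nil
  then show ?case by (simp add: total_completion_def spt_cost_def)
next
  case (snoc x xs)
  have "total_completion I (set xs) (list_start I (xs @ [x]))
      = total_completion I (set xs) (list_start I xs)"
    using snoc.prems by (auto simp: total_completion_def completion_def list_start_snoc intro!: sum.cong)
  then have "total_completion I (set (xs @ [x])) (list_start I (xs @ [x]))
      = spt_cost (ptime I) (set xs) + sum (ptime I) (set xs) + ptime I x"
    using snoc list_start_last[of xs x I]
    by (simp add: total_completion_def completion_def sorted_append)
  also have "\<dots> = spt_cost (ptime I) (set (xs @ [x]))"
    using snoc.prems spt_cost_insert[of "set xs" x "ptime I"] by (simp add: sorted_append)
  finally show ?case .
qed

lemma list_start_nonneg:
  assumes "\<And>j. j \<in> set xs \<Longrightarrow> ptime I j \<ge> 0"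
  shows "list_start I xs j \<ge> 0"
  unfolding list_start_def using assms
  by (intro sum_list_nonneg) (auto dest!: set_takeWhileD)

lemma completion_list_start_le:
  assumes "distinct xs" "\<And>j. j \<in> set xs \<Longrightarrow> ptime I j \<ge> 0" "j \<in> set xs"
  shows "completion I (list_start I xs) j \<le> sum (ptime I) (set xs)"
  using assms
proof (induction xs rule: rev_induct)
  case Nil
  then show ?case by simp
next
  case (snoc x xs)
  show ?case
  proof (cases "j = x")
    case True
    then show ?thesis
      using snoc.prems list_start_last[of xs x I] by (simp add: completion_def)
  next
    case False
    then have "completion I (list_start I xs) j \<le> sum (ptime I) (set xs)"
      using snoc by simp
    moreover have "ptime I x \<ge> 0" using snoc.prems by simp
    ultimately show ?thesis
      using snoc.prems(1,3) False by (simp add: completion_def list_start_snoc)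
  qed
qed

lemma list_start_disjoint:
  assumes "distinct xs" "\<And>j. j \<in> set xs \<Longrightarrow> ptime I j \<ge> 0"
    and "i \<in> set xs" "j \<in> set xs" "i \<noteq> j"
  shows "completion I (list_start I xs) i \<le> list_start I xs j
    \<or> completion I (list_start I xs) j \<le> list_start I xs i"
  using assms
proof (induction xs rule: rev_induct)
  case Nil
  then show ?case by simp
next
  case (snoc x xs)
  \<comment> \<open>The appended job starts at the total processing time of \<open>xs\<close>, by
    which every job of \<open>xs\<close> has completed.\<close>
  have last: "completion I (list_start I (xs @ [x])) k \<le> list_start I (xs @ [x]) x" if "k \<in> set xs" for k
    using that snoc.prems completion_list_start_le[of xs I k] list_start_last[of xs x I]
    by (simp add: completion_def list_start_snoc)
  consider "i = x" "j \<in> set xs" | "j = x" "i \<in> set xs" | "i \<in> set xs" "j \<in> set xs"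
    using snoc.prems by auto
  then show ?case
  proof cases
    case 3
    then show ?thesis
      using snoc by (simp add: completion_def list_start_snoc)
  qed (use last in auto)
qed

lemma feasible_list_start:
  assumes "valid_inst I" "distinct xs" "set xs \<subseteq> jobs I" "(\<Sum>j\<in>set xs. profit I j) \<ge> target I"
  shows "feasible I (set xs) (list_start I xs)"
proof -
  have "ptime I j \<ge> 0" if "j \<in> set xs" for j
    using assms(1,3) that by (auto simp: valid_inst_def less_imp_le)
  then show ?thesis
    using assms by (auto simp: feasible_def list_start_nonneg dest: list_start_disjoint)
qed

section \<open>Lower bound for arbitrary schedules\<close>

text \<open>The opposite order would give \<open>s j < s i\<close>, as \<open>ptime I j\<close> is
  positive. In particular, distinct jobs never start together.\<close>

lemma completion_le_start_of_later:
  assumes "valid_inst I" "feasible I S s" "i \<in> S" "j \<in> S" "i \<noteq> j" "s i \<le> s j"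
  shows "completion I s i \<le> s j"
proof -
  have "ptime I j > 0" using assms by (auto simp: valid_inst_def feasible_def)
  moreover have "completion I s i \<le> s j \<or> completion I s j \<le> s i"
    using assms by (auto simp: feasible_def)
  ultimately show ?thesis
    using assms(6) by (auto simp: completion_def)
qed

text \<open>Remove the job \<open>x\<close> that starts last: all others complete by
  \<open>s x\<close>, so the induction hypothesis applies with horizon \<open>s x\<close> in place
  of \<open>t\<close>.\<close>

lemma sum_ptime_le_horizon:
  assumes "valid_inst I" "feasible I S s" "finite T" "T \<subseteq> S" "t \<ge> 0"
    and "\<And>j. j \<in> T \<Longrightarrow> completion I s j \<le> t"
  shows "sum (ptime I) T \<le> t"
  using \<open>finite T\<close> assms(4-6)
proof (induction T arbitrary: t rule: finite_ranking_induct[where f = s])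
  case empty
  then show ?case by simp
next
  case (insert x T)
  show ?case
  proof (cases "x \<in> T")
    case True
    then show ?thesis using insert by (simp add: insert_absorb)
  next
    case False
    have "completion I s j \<le> s x" if "j \<in> T" for j
      using that False insert.prems insert.hyps
      by (intro completion_le_start_of_later[OF assms(1,2)]) auto
    moreover have "s x \<ge> 0" using insert.prems assms(2) by (auto simp: feasible_def)
    ultimately have "sum (ptime I) T \<le> s x" using insert.IH insert.prems by simp
    moreover have "completion I s x \<le> t" using insert.prems by simp
    ultimately show ?thesis
      using False insert.hyps by (simp add: completion_def)
  qed
qed

lemma feasible_finite:
  assumes "valid_inst I" "feasible I S s"
  shows "finite S"
  using assms by (auto simp: valid_inst_def feasible_def intro: finite_subset)

lemma spt_cost_le_total_completion:
  assumes "valid_inst I" "feasible I S s"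
  shows "spt_cost (ptime I) S \<le> total_completion I S s"
proof -
  let ?p = "ptime I" and ?before = "\<lambda>i j. if s i < s j then ptime I i else 0"
  have fin: "finite S" using assms by (rule feasible_finite)
  have start: "(\<Sum>i\<in>S. ?before i j) \<le> s j" if "j \<in> S" for j
  proof -
    have "sum ?p {i \<in> S. s i < s j} \<le> s j"
      using assms that fin
      by (intro sum_ptime_le_horizon[OF assms])
        (auto simp: feasible_def intro!: completion_le_start_of_later[OF assms])
    then show ?thesis
      using fin by (simp add: sum.If_cases Int_def)
  qed
  \<comment> \<open>For distinct jobs exactly one of the two \<open>?before\<close> terms is
    nonzero, namely the time of the earlier job; on the diagonal both vanish.\<close>
  have pair: "min (?p i) (?p j) \<le> ?before i j + ?before j i + (if i = j then ?p j else 0)"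
    if "i \<in> S" "j \<in> S" for i j
  proof -
    have "?p i > 0" "?p j > 0"
      using that assms by (auto simp: valid_inst_def feasible_def)
    then show ?thesis
      using completion_le_start_of_later[OF assms that] completion_le_start_of_later[OF assms that(2,1)]
      by (cases "i = j"; cases "s i = s j") (auto simp: completion_def)
  qed
  have "(\<Sum>i\<in>S. \<Sum>j\<in>S. min (?p i) (?p j))
      \<le> (\<Sum>i\<in>S. \<Sum>j\<in>S. ?before i j + ?before j i + (if i = j then ?p j else 0))"
    by (intro sum_mono pair)
  also have "\<dots> = (\<Sum>i\<in>S. \<Sum>j\<in>S. ?before i j) + (\<Sum>i\<in>S. \<Sum>j\<in>S. ?before j i) + sum ?p S"
    using fin by (simp add: sum.distrib)
  \<comment> \<open>After the swap both double sums add up, for each job, the work started before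
    it, so each is at most \<open>sum s S\<close>.\<close>
  also have "(\<Sum>i\<in>S. \<Sum>j\<in>S. ?before i j) = (\<Sum>j\<in>S. \<Sum>i\<in>S. ?before i j)"
    by (rule sum.swap)
  also have "(\<Sum>j\<in>S. \<Sum>i\<in>S. ?before i j) + (\<Sum>i\<in>S. \<Sum>j\<in>S. ?before j i) + sum ?p S
      \<le> sum s S + sum s S + sum ?p S"
    by (intro add_mono sum_mono start order_refl)
  finally show ?thesis
    by (simp add: spt_cost_def total_completion_def completion_def sum.distrib)
qed

lemma ptime_le_total_completion:
  assumes "valid_inst I" "feasible I S s" "j \<in> S"
  shows "ptime I j \<le> total_completion I S s"
proof -
  have nonneg: "s i \<ge> 0" "ptime I i > 0" if "i \<in> S" for i
    using that assms by (auto simp: valid_inst_def feasible_def)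
  have "ptime I j \<le> completion I s j"
    using nonneg assms(3) by (simp add: completion_def)
  also have "\<dots> \<le> total_completion I S s"
    unfolding total_completion_def using nonneg assms(3) feasible_finite[OF assms(1,2)]
    by (intro member_le_sum) (auto simp: completion_def less_imp_le)
  finally show ?thesis .
qed

section \<open>Rounding and the approximation guarantee\<close>

lemma Opt_eq_total_completion:
  assumes "optimal I S s"
  shows "Opt I = total_completion I S s"
  unfolding Opt_def using assms by (intro cInf_eq_minimum) (auto simp: optimal_def)

lemma valid_rounded_inst:
  assumes "valid_inst I" "K > 0"
  shows "valid_inst (rounded_inst Pmax K I)"
  using assms by (auto simp: valid_inst_def rounded_inst_def)

text \<open>The bound on processing times keeps all of \<open>S\<close> in the rounded instance,
  where \<open>S\<close> then competes with the optimal \<open>S'\<close>. Of \<open>s'\<close> only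
  its cost matters.\<close>

lemma spt_cost_optimal_rounded_le:
  assumes "valid_inst I" "K > 0" "optimal (rounded_inst Pmax K I) S' s'"
    and "feasible I S s" "\<And>j. j \<in> S \<Longrightarrow> ptime I j \<le> Pmax"
  shows "spt_cost (ptime I) S' \<le> spt_cost (ptime I) S + K * (real (card S) * (real (card S) + 1)) / 2"
proof -
  let ?R = "rounded_inst Pmax K I"
  have valid: "valid_inst ?R" using assms(1,2) by (rule valid_rounded_inst)
  have "finite S" using assms(1,4) by (rule feasible_finite)
  then obtain zs where "set zs = S" "distinct zs"
    using finite_distinct_list by blast
  \<comment> \<open>Sorting by rounded times makes the rounded cost of \<open>S\<close> equal to its
    \<open>spt_cost\<close>.\<close>
  then obtain ys where ys: "set ys = S" "distinct ys" "sorted (map (ptime ?R) ys)"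
    using that[of "sort_key (ptime ?R) zs"] by simp
  have "S \<subseteq> jobs ?R" "(\<Sum>j\<in>S. profit ?R j) \<ge> target ?R"
    using assms(4,5) by (auto simp: feasible_def rounded_inst_def)
  then have feas: "feasible ?R S (list_start ?R ys)"
    using feasible_list_start[OF valid ys(2)] ys(1) by simp
  have round: "ptime I j \<le> K * ptime ?R j" "K * ptime ?R j \<le> ptime I j + K" for j
  proof -
    have "ptime I j / K \<le> ptime ?R j" "ptime ?R j \<le> ptime I j / K + 1"
      by (simp_all add: rounded_inst_def)
    then show "ptime I j \<le> K * ptime ?R j" "K * ptime ?R j \<le> ptime I j + K"
      using assms(2) by (simp_all add: field_simps)
  qed
  have "spt_cost (ptime I) S' \<le> K * spt_cost (ptime ?R) S'"
    using spt_cost_mono[of S' "ptime I" "\<lambda>j. K * ptime ?R j"] round(1) assms(2)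
    by (simp add: spt_cost_scale)
  also have "spt_cost (ptime ?R) S' \<le> total_completion ?R S' s'"
    using assms(3) by (intro spt_cost_le_total_completion valid) (simp add: optimal_def)
  also have "total_completion ?R S' s' \<le> total_completion ?R S (list_start ?R ys)"
    using assms(3) feas by (simp add: optimal_def)
  also have "\<dots> = spt_cost (ptime ?R) S"
    using total_completion_sorted_list[OF ys(2,3)] ys(1) by simp
  also have "K * \<dots> \<le> spt_cost (\<lambda>j. ptime I j + K) S"
    using spt_cost_mono[of S "\<lambda>j. K * ptime ?R j" "\<lambda>j. ptime I j + K"] round(2) assms(2)
    by (simp add: spt_cost_scale)
  finally show ?thesis
    using assms(2) by (simp add: spt_cost_add_const)
qed

theorem theorem3p4:
  fixes I :: "'a sched_inst" and \<epsilon> Pmax K :: real and n :: nat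
    and S S' :: "'a set" and s s' :: "'a \<Rightarrow> real" and xs :: "'a list"
  assumes "\<epsilon> > 0"
    and "valid_inst I"
    and "n = card (jobs I)"
    and "optimal I S s"
    and "Pmax = Max (ptime I ` S)"
    and "K = 2 * \<epsilon> * Pmax / (real n * (real n + 1))"
    and "optimal (rounded_inst Pmax K I) S' s'"
    and "distinct xs" and "set xs = S'" and "sorted (map (ptime I) xs)"
  shows "total_completion I S' (list_start I xs) \<le> (1 + \<epsilon>) * Opt I"
proof -
  have feas: "feasible I S s" using assms(4) by (simp add: optimal_def)
  have fin: "finite S" using assms(2) feas by (rule feasible_finite)
  \<comment> \<open>The empty selection has profit 0, below the positive target.\<close>
  have "S \<noteq> {}" using feas assms(2) by (auto simp: feasible_def valid_inst_def)
  then have "Pmax \<in> ptime I ` S" using fin assms(5) by simp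
  then obtain m where m: "m \<in> S" "Pmax = ptime I m" by auto
  have Pmax_pos: "Pmax > 0" and Pmax_le: "Pmax \<le> Opt I"
    using m feas assms(2) ptime_le_total_completion[OF assms(2) feas m(1)]
    by (auto simp: feasible_def valid_inst_def Opt_eq_total_completion[OF assms(4)])
  have card_le: "card S \<le> n"
    using feas assms(2,3) by (auto simp: feasible_def valid_inst_def intro: card_mono)
  have "card S > 0" using fin \<open>S \<noteq> {}\<close> by (simp add: card_gt_0_iff)
  then have n_pos: "real n > 0" using card_le by simp
  then have denom_pos: "real n * (real n + 1) > 0" by (simp add: add_pos_pos)
  then have K_pos: "K > 0" using Pmax_pos assms(1,6) by simp
  have "total_completion I S' (list_start I xs) = spt_cost (ptime I) S'"
    using total_completion_sorted_list assms(8-10) by blast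
  also have "\<dots> \<le> spt_cost (ptime I) S + K * (real (card S) * (real (card S) + 1)) / 2"
    using fin assms(5) by (intro spt_cost_optimal_rounded_le[OF assms(2) K_pos assms(7) feas]) simp
  also have "spt_cost (ptime I) S \<le> Opt I"
    using spt_cost_le_total_completion[OF assms(2) feas] Opt_eq_total_completion[OF assms(4)] by simp
  also have "K * (real (card S) * (real (card S) + 1)) / 2 \<le> K * (real n * (real n + 1)) / 2"
    using K_pos card_le by (intro divide_right_mono mult_left_mono mult_mono) auto
  \<comment> \<open>The denominator of \<open>K\<close> is chosen to cancel the factor
    \<open>n (n + 1)\<close> here.\<close>
  also have "\<dots> = \<epsilon> * Pmax" using assms(6) n_pos denom_pos by auto
  also have "\<dots> \<le> \<epsilon> * Opt I" using Pmax_le assms(1) by simp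
  finally show ?thesis by (simp add: distrib_right)
qed

end
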